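(* Let $d\ge 1$, let $\varepsilon\in(0,1/2)$, and let $\mu_0,\mu_1,\dots,\mu_d$ be absolutely continuous probability measures on $\mathbb R^d$ that are $\varepsilon$-not-permuted. Then there exists a halfspace $H\subset\mathbb R^d$ such that \[ \mu_0(H)=\mu_1(H)=\dots=\mu_d(H)\in[\varepsilon,1/2]. \]
   Context: A halfspace is a set $\{x\in\mathbb R^d:\langle u,x\rangle\ge c\}$ with $u\neq 0$ (since the measures are absolutely continuous, whether it is open or closed is irrelevant). Definition: for $\varepsilon\in(0,1/2)$, absolutely continuous probability measures $\mu_0,\dots,\mu_d$ on $\mathbb R^d$ are called $\varepsilon$-not-permuted if for every halfspace $H$ such that $\mu_i(H)<\varepsilon$ for all $i=0,1,\dots,d$, there exist indices $i<j$ with $\mu_i(H)\ge\mu_j(H)$. *)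

theory Defs
  imports "HOL-Probability.Probability"
begin

definition halfspace :: "'a::euclidean_space \<Rightarrow> real \<Rightarrow> 'a set" where
  "halfspace u c = {x. inner u x \<ge> c}"

definition is_halfspace :: "'a::euclidean_space set \<Rightarrow> bool" where
  "is_halfspace H \<longleftrightarrow> (\<exists>u c. u \<noteq> 0 \<and> H = halfspace u c)"

definition ac_prob_measure :: "'a::euclidean_space measure \<Rightarrow> bool" where
  "ac_prob_measure M \<longleftrightarrow> prob_space M \<and> sets M = sets borel \<and> absolutely_continuous lborel M"

definition not_permuted :: "real \<Rightarrow> (nat \<Rightarrow> 'a::euclidean_space measure) \<Rightarrow> bool" where
  "not_permuted eps \<mu> \<longleftrightarrow>
     (\<forall>H. is_halfspace H \<longrightarrow> (\<forall>i\<le>DIM('a). measure (\<mu> i) H < eps) \<longrightarrow>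
        (\<exists>i j. i < j \<and> j \<le> DIM('a) \<and> measure (\<mu> i) H \<ge> measure (\<mu> j) H))"

end

theory Submission
  imports Defs "HOL-Homology.Invariance_of_Domain"
begin

text \<open>
  The unit sphere of \<open>'a \<times> real\<close> parametrizes halfspaces, with antipodes giving complements, and the
  differences \<open>\<mu>\<^sub>i\<^sub>+\<^sub>1(H) - \<mu>\<^sub>i(H)\<close> form an odd map into \<open>d\<close>-space. It has unwanted zeros, where all measures
  agree but are below \<open>eps\<close> or above \<open>1 - eps\<close>. Since the measures are not permuted, near those zeros the
  map avoids the positive (resp. negative) orthant, so an odd perturbation along the diagonal of the
  orthant removes them without creating new ones. The Borsuk-Ulam theorem then provides a zero at
  which all measures agree on a value in \<open>[eps, 1 - eps]\<close>; pass to the complement if it exceeds \<open>1/2\<close>.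

  For Borsuk-Ulam, approximate by odd polynomial maps and show that an odd polynomial self-map of a
  sphere has odd degree. By induction on the dimension: for polynomial maps a generic direction
  is missed by the cone over the image of the equator, which allows an explicit odd homotopy to a map
  preserving the equator, and the library's parity comparison between the degree of such a map and that
  of its restriction to the equator applies.
\<close>


section \<open>Radial normalization into the sphere \<open>nsphere n\<close>\<close>

text \<open>Coordinates above \<open>n\<close> are set to 0 because \<open>nsphere n\<close>
  consists of sequences that vanish there.\<close>

definition sphere_normalize :: "nat \<Rightarrow> ('x \<Rightarrow> nat \<Rightarrow> real) \<Rightarrow> 'x \<Rightarrow> nat \<Rightarrow> real" where
  "sphere_normalize n f x = (\<lambda>i. if i \<le> n then f x i / sqrt (\<Sum>j\<le>n. (f x j)\<^sup>2) else 0)"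

lemma sum_squares_pos:
  fixes g :: "nat \<Rightarrow> real"
  assumes "\<exists>i\<le>n. g i \<noteq> 0"
  shows "(\<Sum>j\<le>n. (g j)\<^sup>2) > 0"
proof -
  obtain i where "i \<le> n" "g i \<noteq> 0" using assms by blast
  then show ?thesis
    by (intro sum_pos2[of _ i]) auto
qed

lemma sphere_normalize_in_nsphere:
  assumes "\<exists>i\<le>n. f x i \<noteq> 0"
  shows "sphere_normalize n f x \<in> topspace (nsphere n)"
proof -
  let ?r = "\<Sum>j\<le>n. (f x j)\<^sup>2"
  have r: "?r > 0" using sum_squares_pos[of n "f x"] assms by blast
  have "(\<Sum>i\<le>n. (sphere_normalize n f x i)\<^sup>2) = (\<Sum>i\<le>n. (f x i)\<^sup>2 / ?r)"
    using r by (intro sum.cong) (auto simp: sphere_normalize_def power_divide)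
  also have "\<dots> = 1"
    using r by (simp flip: sum_divide_distrib)
  finally show ?thesis
    by (simp add: nsphere sphere_normalize_def)
qed

lemma continuous_map_sphere_normalize:
  assumes cont: "\<And>i. i \<le> n \<Longrightarrow> continuous_map X euclideanreal (\<lambda>x. f x i)"
    and nz: "\<And>x. x \<in> topspace X \<Longrightarrow> \<exists>i\<le>n. f x i \<noteq> 0"
  shows "continuous_map X (nsphere n) (sphere_normalize n f)"
proof -
  have "continuous_map X euclideanreal (\<lambda>x. sphere_normalize n f x i)" for i
  proof (cases "i \<le> n")
    case True
    have "continuous_map X euclideanreal (\<lambda>x. f x i / sqrt (\<Sum>j\<le>n. (f x j)\<^sup>2))"
    proof (intro continuous_map_real_divide continuous_map_sqrt continuous_map_sum continuous_map_real_pow cont True)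
      fix x assume "x \<in> topspace X"
      then show "sqrt (\<Sum>j\<le>n. (f x j)\<^sup>2) \<noteq> 0"
        using sum_squares_pos[of n "f x"] nz by (metis less_numeral_extra(3) real_sqrt_eq_zero_cancel_iff)
    qed auto
    then show ?thesis using True by (simp add: sphere_normalize_def)
  next
    case False then show ?thesis by (simp add: sphere_normalize_def)
  qed
  then show ?thesis
    using sphere_normalize_in_nsphere[of n f] nz
    by (fastforce simp: nsphere continuous_map_in_subtopology continuous_map_componentwise_UNIV)
qed

lemma sphere_normalize_uminus:
  assumes "\<And>i. i \<le> n \<Longrightarrow> f y i = - f x i"
  shows "sphere_normalize n f y = (\<lambda>i. - sphere_normalize n f x i)"
proof -
  have "(\<Sum>j\<le>n. (f y j)\<^sup>2) = (\<Sum>j\<le>n. (f x j)\<^sup>2)"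
    using assms by (intro sum.cong) auto
  then show ?thesis
    using assms by (auto simp: sphere_normalize_def fun_eq_iff)
qed

lemma sphere_normalize_Suc:
  assumes "f x (Suc n) = 0"
  shows "sphere_normalize (Suc n) f x = sphere_normalize n f x"
  using assms by (auto simp: sphere_normalize_def fun_eq_iff le_Suc_eq)

lemma sphere_normalize_cong:
  assumes "\<And>i. i \<le> n \<Longrightarrow> f x i = g y i"
  shows "sphere_normalize n f x = sphere_normalize n g y"
  using assms by (auto simp: sphere_normalize_def fun_eq_iff)

text \<open>Normalizing a homotopy without zeros gives a homotopy of sphere maps, so homotopies can
  be written down by unnormalized formulas.\<close>

lemma Brouwer_degree2_sphere_normalize_homotopic:
  assumes cont: "\<And>i. i \<le> n \<Longrightarrow>
      continuous_map (prod_topology (top_of_set {0..1}) (nsphere n)) euclideanreal (\<lambda>(s,x). H s x i)"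
    and nz: "\<And>s x. s \<in> {0..1::real} \<Longrightarrow> x \<in> topspace (nsphere n) \<Longrightarrow> \<exists>i\<le>n. H s x i \<noteq> 0"
  shows "Brouwer_degree2 n (sphere_normalize n (H 0)) = Brouwer_degree2 n (sphere_normalize n (H 1))"
proof (rule Brouwer_degree2_homotopic)
  have "continuous_map (prod_topology (top_of_set {0..1}) (nsphere n)) (nsphere n)
          (sphere_normalize n (\<lambda>(s,x). H s x))"
    using cont nz by (intro continuous_map_sphere_normalize) (auto simp: case_prod_unfold)
  then show "homotopic_with (\<lambda>x. True) (nsphere n) (nsphere n) (sphere_normalize n (H 0)) (sphere_normalize n (H 1))"
    unfolding homotopic_with_def
    by (intro exI[of _ "sphere_normalize n (\<lambda>(s,x). H s x)"]) (auto simp: sphere_normalize_def)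
qed

section \<open>Odd polynomial maps of spheres have odd degree\<close>

text \<open>The 0-sphere is a pair of antipodes, so an odd self-map is the identity or the swap, of
  degree 1 or -1.\<close>

lemma odd_Brouwer_degree2_0:
  assumes cont: "continuous_map (nsphere 0) (nsphere 0) f"
    and odd: "\<And>x. x \<in> topspace (nsphere 0) \<Longrightarrow> f (\<lambda>i. - x i) = (\<lambda>i. - f x i)"
  shows "odd (Brouwer_degree2 0 f)"
proof -
  define p :: "nat \<Rightarrow> real" where "p = (\<lambda>i. if i = 0 then 1 else 0)"
  have top: "topspace (nsphere 0) = {p, \<lambda>i. - p i}"
    by (auto simp: nsphere p_def fun_eq_iff power2_eq_1_iff)
  have neg: "f (\<lambda>i. - p i) = (\<lambda>i. - f p i)" using odd top by blast
  have "f p \<in> topspace (nsphere 0)"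
    using cont top by (auto simp: continuous_map_def)
  then consider "f p = p" | "f p = (\<lambda>i. - p i)" using top by blast
  then show ?thesis
  proof cases
    case 1
    then have "Brouwer_degree2 0 f = Brouwer_degree2 0 id"
      using neg top by (intro Brouwer_degree2_eq) auto
    then show ?thesis by simp
  next
    case 2
    have "Brouwer_degree2 0 f = Brouwer_degree2 0 (\<lambda>x i. if i = 0 then - x i else x i)"
    proof (rule Brouwer_degree2_eq)
      fix x assume "x \<in> topspace (nsphere 0)"
      then have "x = p \<or> x = (\<lambda>i. - p i)" using top by blast
      moreover have "(\<lambda>i. if i = 0 then - x i else x i) = (\<lambda>i. - x i)" if "x = p \<or> x = (\<lambda>i. - p i)"
        using that by (auto simp: p_def)
      ultimately show "f x = (\<lambda>i. if i = 0 then - x i else x i)" using neg 2 by auto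
    qed
    then show ?thesis by (simp add: Brouwer_degree2_reflection)
  qed
qed

text \<open>Numbering the basis links two settings: degrees live on spheres of real sequences,
  polynomial functions and negligible sets on Euclidean types.\<close>

locale basis_enumeration =
  fixes b :: "nat \<Rightarrow> 'b::euclidean_space"
  assumes bij_b: "bij_betw b {..<DIM('b)} Basis"
begin

definition emb :: "(nat \<Rightarrow> real) \<Rightarrow> 'b" where
  "emb x = (\<Sum>i<DIM('b). x i *\<^sub>R b i)"

lemma inner_b:
  assumes "i < DIM('b)" "j < DIM('b)"
  shows "b i \<bullet> b j = (if i = j then 1 else 0)"
proof -
  have "b i \<in> Basis" "b j \<in> Basis" "b i = b j \<longleftrightarrow> i = j"
    using bij_b assms by (auto simp: bij_betw_def inj_on_def)
  then show ?thesis by (simp add: inner_Basis)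
qed

lemma sum_inner_b:
  assumes "finite I" "I \<subseteq> {..<DIM('b)}" "i < DIM('b)"
  shows "(\<Sum>k\<in>I. x k *\<^sub>R b k) \<bullet> b i = (if i \<in> I then x i else 0)"
proof -
  have "(\<Sum>k\<in>I. x k *\<^sub>R b k) \<bullet> b i = (\<Sum>k\<in>I. if k = i then x k else 0)"
    unfolding inner_sum_left using assms by (intro sum.cong) (auto simp: inner_b subset_iff)
  then show ?thesis using assms by simp
qed

lemma emb_inner [simp]: "i < DIM('b) \<Longrightarrow> emb x \<bullet> b i = x i"
  unfolding emb_def by (subst sum_inner_b) auto

lemma eq_iff_inner_b: "u = v \<longleftrightarrow> (\<forall>i<DIM('b). u \<bullet> b i = v \<bullet> b i)"
proof -
  have "(\<forall>c\<in>Basis. u \<bullet> c = v \<bullet> c) \<longleftrightarrow> (\<forall>i<DIM('b). u \<bullet> b i = v \<bullet> b i)"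
    using bij_b by (force simp: bij_betw_def)
  then show ?thesis by (simp add: euclidean_eq_iff[of u v])
qed

lemma emb_uminus: "emb (\<lambda>i. - x i) = - emb x"
  by (simp add: eq_iff_inner_b)

lemma norm_emb: "norm (emb x) = sqrt (\<Sum>i<DIM('b). (x i)\<^sup>2)"
proof -
  have "emb x \<bullet> emb x = (\<Sum>i<DIM('b). x i * x i)"
    by (subst (2) emb_def) (simp add: inner_sum_right)
  then show ?thesis by (simp add: norm_eq_sqrt_inner power2_eq_square)
qed

lemma continuous_map_emb: "continuous_map (nsphere n) euclidean emb"
proof -
  have "continuous_map (nsphere n) euclidean (\<lambda>x. x i *\<^sub>R b i)" for i
  proof -
    have "continuous_map euclidean euclidean (\<lambda>t::real. t *\<^sub>R b i)"
      by (simp add: continuous_on_scaleR)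
    from continuous_map_compose[OF continuous_map_nsphere_projection[of n i] this]
    show ?thesis by (simp add: o_def)
  qed
  then show ?thesis unfolding emb_def by (intro continuous_map_sum) auto
qed

lemma continuous_map_coords_emb:
  fixes q :: "'b \<Rightarrow> 'b"
  assumes "continuous_on UNIV q"
  shows "continuous_map (nsphere n) euclideanreal (\<lambda>x. q (emb x) \<bullet> b i)"
proof -
  have "continuous_map euclidean euclidean (\<lambda>y. q y \<bullet> b i)"
    using assms by (simp add: continuous_on_inner)
  from continuous_map_compose[OF continuous_map_emb this] show ?thesis by (simp add: o_def)
qed

text \<open>Scaling a point of the cylinder by \<open>c\<close> multiplies the sum of squares by the
  square of \<open>c\<close>, so each ray from the origin meets it at most once.\<close>

lemma negligible_cylinder: "negligible {y::'b. (\<Sum>i\<le>m. (y \<bullet> b i)\<^sup>2) = 1}"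
proof (rule starlike_negligible[where a = 0])
  show "closed {y::'b. (\<Sum>i\<le>m. (y \<bullet> b i)\<^sup>2) = 1}"
    by (intro closed_Collect_eq continuous_intros)
  fix c :: real and x :: 'b
  assume c: "0 \<le> c" and x: "0 + x \<in> {y. (\<Sum>i\<le>m. (y \<bullet> b i)\<^sup>2) = 1}"
    and cx: "0 + c *\<^sub>R x \<in> {y. (\<Sum>i\<le>m. (y \<bullet> b i)\<^sup>2) = 1}"
  have "(\<Sum>i\<le>m. (c *\<^sub>R x \<bullet> b i)\<^sup>2) = c\<^sup>2 * (\<Sum>i\<le>m. (x \<bullet> b i)\<^sup>2)"
    by (simp add: sum_distrib_left power_mult_distrib)
  with x cx have "c\<^sup>2 = 1" by simp
  with c show "c = 1" by (simp add: power2_eq_1_iff)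
qed

text \<open>
  The cone over a smooth image of the \<open>m\<close>-sphere is negligible in \<open>m + 2\<close> dimensions. As the dimension
  of the type is fixed, the unused coordinates are carried along unchanged.
\<close>

lemma generic_direction:
  fixes q :: "'b \<Rightarrow> 'b"
  assumes q: "polynomial_function q" and m: "Suc m < DIM('b)"
  obtains v :: "nat \<Rightarrow> real" where "v (Suc m) \<noteq> 0"
    and "\<And>x t. x \<in> topspace (nsphere m) \<Longrightarrow> \<exists>i\<le>Suc m. t * (q (emb x) \<bullet> b i) \<noteq> v i"
proof -
  let ?n = "Suc m"
  define \<pi> :: "'b \<Rightarrow> 'b" where "\<pi> y = (\<Sum>i\<le>m. (y \<bullet> b i) *\<^sub>R b i)" for y
  \<comment> \<open>Coordinate \<open>?n\<close> of \<open>y\<close> plays the role of the scalar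
    \<open>t\<close>, and the coordinates up to \<open>m\<close> that of the sphere point. Thus
    \<open>F\<close> maps \<open>?S\<close> onto all points whose first \<open>m + 2\<close>
    coordinates lie in the cone.\<close>
  define F :: "'b \<Rightarrow> 'b" where
    "F y = (y \<bullet> b ?n) *\<^sub>R (\<Sum>i\<le>?n. (q (\<pi> y) \<bullet> b i) *\<^sub>R b i)
           + (\<Sum>i\<in>{?n<..<DIM('b)}. (y \<bullet> b i) *\<^sub>R b i)" for y
  let ?S = "{y::'b. (\<Sum>i\<le>m. (y \<bullet> b i)\<^sup>2) = 1}"
  have "polynomial_function \<pi>"
    unfolding \<pi>_def by (intro polynomial_function_sum polynomial_function_mult polynomial_function_inner) auto
  then have q\<pi>: "polynomial_function (\<lambda>y. q (\<pi> y))"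
    using polynomial_function_compose[OF _ q, of \<pi>] by (simp add: o_def)
  have "polynomial_function F"
    unfolding F_def
    by (intro polynomial_function_add polynomial_function_sum polynomial_function_mult
        polynomial_function_inner q\<pi>) auto
  then have "negligible (F ` ?S)"
    by (intro negligible_differentiable_image_negligible differentiable_on_polynomial_function
        negligible_cylinder) auto
  \<comment> \<open>Avoiding this hyperplane as well makes the last relevant coordinate of the
    direction nonzero.\<close>
  moreover have "negligible {y. b ?n \<bullet> y = 0}"
    using inner_b[of ?n ?n] m by (intro negligible_hyperplane) auto
  ultimately have "F ` ?S \<union> {y. b ?n \<bullet> y = 0} \<noteq> UNIV"
    using non_negligible_UNIV negligible_Un by metis
  then obtain w where w: "w \<notin> F ` ?S" "w \<bullet> b ?n \<noteq> 0" by (auto simp: inner_commute)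
  show thesis
  proof (rule that[of "\<lambda>i. w \<bullet> b i"])
    show "w \<bullet> b ?n \<noteq> 0" by (rule w)
    fix x t assume x: "x \<in> topspace (nsphere m)"
    show "\<exists>i\<le>?n. t * (q (emb x) \<bullet> b i) \<noteq> w \<bullet> b i"
    proof (rule ccontr)
      assume "\<not> ?thesis"
      then have eq: "t * (q (emb x) \<bullet> b i) = w \<bullet> b i" if "i \<le> ?n" for i using that by blast
      define y where "y = emb (\<lambda>i. if i \<le> m then x i else if i = ?n then t else w \<bullet> b i)"
      have y: "y \<bullet> b i = (if i \<le> m then x i else if i = ?n then t else w \<bullet> b i)" if "i < DIM('b)" for i
        using that by (simp add: y_def)
      have "\<pi> y = emb x"
      proof -
        have "\<pi> y \<bullet> b i = emb x \<bullet> b i" if "i < DIM('b)" for i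
          unfolding \<pi>_def using x m that y by (subst sum_inner_b) (auto simp: nsphere)
        then show ?thesis by (simp add: eq_iff_inner_b)
      qed
      have "F y = w"
      proof -
        have "F y \<bullet> b i = w \<bullet> b i" if i: "i < DIM('b)" for i
        proof -
          have "(\<Sum>k\<le>?n. (q (\<pi> y) \<bullet> b k) *\<^sub>R b k) \<bullet> b i = (if i \<le> ?n then q (\<pi> y) \<bullet> b i else 0)"
            using m i by (subst sum_inner_b) auto
          moreover have "(\<Sum>k\<in>{?n<..<DIM('b)}. (y \<bullet> b k) *\<^sub>R b k) \<bullet> b i = (if ?n < i then y \<bullet> b i else 0)"
            using m i by (subst sum_inner_b) auto
          ultimately show ?thesis
            using eq[of i] y[OF i] y[OF m] m \<open>\<pi> y = emb x\<close> unfolding F_def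
            by (auto simp: inner_add_left)
        qed
        then show ?thesis by (simp add: eq_iff_inner_b)
      qed
      moreover have "y \<in> ?S"
      proof -
        have "(\<Sum>i\<le>m. (y \<bullet> b i)\<^sup>2) = (\<Sum>i\<le>m. (x i)\<^sup>2)"
          using m y by (intro sum.cong) auto
        then show ?thesis using x by (simp add: nsphere)
      qed
      ultimately show False using w by blast
    qed
  qed
qed

text \<open>The map \<open>q\<close> is defined on all of \<open>'b\<close> and only its first
  \<open>n + 1\<close> coordinates matter. The induction can therefore pass to the equator without
  changing the type, and the deformed map has to be polynomial again.\<close>

lemma odd_degree_polynomial:
  fixes q :: "'b \<Rightarrow> 'b"
  assumes "polynomial_function q" and "\<And>x. q (- x) = - q x" and "n < DIM('b)"
    and "\<And>x. x \<in> topspace (nsphere n) \<Longrightarrow> \<exists>i\<le>n. q (emb x) \<bullet> b i \<noteq> 0"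
  shows "odd (Brouwer_degree2 n (sphere_normalize n (\<lambda>x i. q (emb x) \<bullet> b i)))"
  using assms
proof (induction n arbitrary: q)
  case 0
  have "continuous_on UNIV q"
    using 0 by (simp add: continuous_on_polymonial_function)
  with 0 show ?case
    by (intro odd_Brouwer_degree2_0 continuous_map_sphere_normalize continuous_map_coords_emb
         sphere_normalize_uminus) (auto simp: emb_uminus)
next
  case (Suc m)
  let ?n = "Suc m"
  note poly_q = Suc.prems(1) and odd_q = Suc.prems(2) and n = Suc.prems(3) and nz = Suc.prems(4)
  have cont_q: "continuous_on UNIV q"
    using poly_q by (simp add: continuous_on_polymonial_function)
  obtain v where vn: "v ?n \<noteq> 0"
    and v: "\<And>x t. x \<in> topspace (nsphere m) \<Longrightarrow> \<exists>i\<le>?n. t * (q (emb x) \<bullet> b i) \<noteq> v i"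
    using generic_direction[OF poly_q n] by metis
  \<comment> \<open>\<open>H\<close> shears \<open>v\<close> onto the last axis while scaling the last coordinate by a factor that, in the end,
    vanishes exactly on the equator; so \<open>H 1\<close> maps the equator into itself and is again polynomial.\<close>
  define w where "w i = v i / v ?n" for i
  define H where "H s x i = (if i = ?n then (1 - s + s * (x ?n)\<^sup>2) * (q (emb x) \<bullet> b ?n)
     else q (emb x) \<bullet> b i - s * (q (emb x) \<bullet> b ?n) * w i)" for s :: real and x i
  \<comment> \<open>On the sphere, the first coordinates of \<open>Q\<close> are those of
    \<open>H 1\<close>. The squared factor is even, which keeps \<open>Q\<close> odd, and
    nonnegative, which keeps the factor in \<open>H\<close> from vanishing before
    \<open>s = 1\<close>.\<close>
  define Q where "Q y = (\<Sum>i\<le>m. (q y \<bullet> b i - (q y \<bullet> b ?n) * w i) *\<^sub>R b i)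
     + ((y \<bullet> b ?n)\<^sup>2 * (q y \<bullet> b ?n)) *\<^sub>R b ?n" for y
  have poly_Q: "polynomial_function Q"
  proof -
    have *: "polynomial_function (\<lambda>y. f y * g y :: real)"
      if "polynomial_function f" "polynomial_function g" for f g :: "'b \<Rightarrow> real"
      using polynomial_function_mult[OF that] by simp
    show ?thesis
      unfolding Q_def power2_eq_square
      by (intro polynomial_function_add polynomial_function_sum polynomial_function_mult
          polynomial_function_diff * polynomial_function_inner poly_q) auto
  qed
  have odd_Q: "Q (- y) = - Q y" for y
    by (simp add: Q_def odd_q flip: sum_negf scaleR_minus_left)
  have Q_H: "Q (emb x) \<bullet> b i = H 1 x i" if "i \<le> ?n" for x i
  proof -
    have "(\<Sum>k\<le>m. (q (emb x) \<bullet> b k - (q (emb x) \<bullet> b ?n) * w k) *\<^sub>R b k) \<bullet> b i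
        = (if i \<le> m then q (emb x) \<bullet> b i - (q (emb x) \<bullet> b ?n) * w i else 0)"
      using n that by (subst sum_inner_b) auto
    then show ?thesis
      using n that by (auto simp: Q_def H_def inner_add_left inner_b)
  qed
  \<comment> \<open>Otherwise the relevant coordinates of \<open>q (emb x)\<close> would be
    proportional to \<open>v\<close>, and a multiple of them would equal \<open>v\<close>, against
    the choice of \<open>v\<close>.\<close>
  have equator: "\<exists>i\<le>m. q (emb x) \<bullet> b i - (q (emb x) \<bullet> b ?n) * w i \<noteq> 0" if x: "x \<in> topspace (nsphere m)" for x
  proof (rule ccontr)
    assume "\<not> ?thesis"
    then have *: "q (emb x) \<bullet> b i = (q (emb x) \<bullet> b ?n) * w i" if "i \<le> m" for i
      using that by auto
    have x': "x \<in> topspace (nsphere ?n)" using x by (auto simp: nsphere)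
    have qn: "q (emb x) \<bullet> b ?n \<noteq> 0"
      using nz[OF x'] * by (metis le_SucE mult_zero_left)
    have "v ?n / (q (emb x) \<bullet> b ?n) * (q (emb x) \<bullet> b i) = v i" if "i \<le> ?n" for i
    proof (cases "i = ?n")
      case False
      then have "i \<le> m" using that by simp
      from *[OF this] show ?thesis using qn vn by (simp add: w_def)
    qed (use qn in simp)
    then show False using v[OF x] by blast
  qed
  have nz_H: "\<exists>i\<le>?n. H s x i \<noteq> 0" if s: "s \<in> {0..1}" and x: "x \<in> topspace (nsphere ?n)" for s x
  proof (rule ccontr)
    assume "\<not> ?thesis"
    then have H0: "H s x i = 0" if "i \<le> ?n" for i using that by blast
    have "q (emb x) \<bullet> b ?n \<noteq> 0"
    proof
      assume "q (emb x) \<bullet> b ?n = 0"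
      then have "q (emb x) \<bullet> b i = 0" if "i \<le> ?n" for i
        using H0[OF that] by (auto simp: H_def split: if_splits)
      then show False using nz[OF x] by blast
    qed
    \<comment> \<open>A zero of \<open>H\<close> forces the scaling factor to vanish, hence
      \<open>s = 1\<close> and \<open>x\<close> on the equator, where \<open>equator\<close>
      excludes it.\<close>
    then have "1 - s + s * (x ?n)\<^sup>2 = 0" using H0[of ?n] by (simp add: H_def)
    moreover have "s * (x ?n)\<^sup>2 \<ge> 0" "1 - s \<ge> 0" using s by auto
    ultimately have "s = 1" by linarith
    with \<open>1 - s + s * (x ?n)\<^sup>2 = 0\<close> have "x ?n = 0" by simp
    then have "x \<in> topspace (nsphere m)" using topspace_nsphere_minus1[OF x] by simp
    from equator[OF this] obtain i where "i \<le> m" "H s x i \<noteq> 0"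
      using \<open>s = 1\<close> by (auto simp: H_def)
    then show False using H0[of i] by simp
  qed
  have contH: "continuous_map (prod_topology (top_of_set {0..1}) (nsphere ?n)) euclideanreal (\<lambda>(s,x). H s x i)" for i
  proof -
    let ?P = "prod_topology (top_of_set {0..1::real}) (nsphere ?n)"
    have 1: "continuous_map ?P euclideanreal fst"
      using continuous_map_fst[of "top_of_set {0..1::real}" "nsphere ?n"] continuous_map_into_fulltopology by blast
    have 2: "continuous_map ?P euclideanreal (\<lambda>p. q (emb (snd p)) \<bullet> b j)" for j
      using continuous_map_compose[OF continuous_map_snd continuous_map_coords_emb[OF cont_q]]
      by (simp add: o_def)
    have 3: "continuous_map ?P euclideanreal (\<lambda>p. snd p ?n)"
      using continuous_map_compose[OF continuous_map_snd continuous_map_nsphere_projection]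
      by (simp add: o_def)
    show ?thesis
      unfolding H_def case_prod_unfold
      by (cases "i = ?n"; simp; intro continuous_map_real_mult continuous_map_add continuous_map_diff
          continuous_map_real_pow 1 2 3; simp)
  qed
  have contQ: "continuous_on UNIV Q"
    using poly_Q by (simp add: continuous_on_polymonial_function)
  let ?f = "sphere_normalize ?n (\<lambda>x i. Q (emb x) \<bullet> b i)"
  have f_m: "?f x = sphere_normalize m (\<lambda>x i. Q (emb x) \<bullet> b i) x" if "x \<in> topspace (nsphere m)" for x
    using that Q_H[of ?n x] by (intro sphere_normalize_Suc) (auto simp: H_def nsphere)
  have nzQ: "\<exists>i\<le>m. Q (emb x) \<bullet> b i \<noteq> 0" if "x \<in> topspace (nsphere m)" for x
    using equator[OF that] Q_H[of _ x] by (fastforce simp: H_def)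
  have "Brouwer_degree2 ?n (sphere_normalize ?n (\<lambda>x i. q (emb x) \<bullet> b i)) = Brouwer_degree2 ?n (sphere_normalize ?n (H 0))"
    by (intro arg_cong[where f = "Brouwer_degree2 ?n"] ext sphere_normalize_cong[THEN fun_cong])
       (auto simp: H_def)
  also have "\<dots> = Brouwer_degree2 ?n (sphere_normalize ?n (H 1))"
    by (intro Brouwer_degree2_sphere_normalize_homotopic contH nz_H)
  also have "\<dots> = Brouwer_degree2 ?n ?f"
    using Q_H by (intro Brouwer_degree2_eq sphere_normalize_cong) auto
  finally have 1: "Brouwer_degree2 ?n (sphere_normalize ?n (\<lambda>x i. q (emb x) \<bullet> b i)) = Brouwer_degree2 ?n ?f" .
  have "even (Brouwer_degree2 ?n ?f - Brouwer_degree2 (?n - Suc 0) ?f)"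
  proof (rule Borsuk_odd_mapping_degree_step)
    show "continuous_map (nsphere ?n) (nsphere ?n) ?f"
      using nz_H[of 1] Q_H by (intro continuous_map_sphere_normalize continuous_map_coords_emb contQ) fastforce
    show "(?f \<circ> (\<lambda>x i. - x i)) u = ((\<lambda>x i. - x i) \<circ> ?f) u" for u
      using sphere_normalize_uminus[of ?n "\<lambda>x i. Q (emb x) \<bullet> b i" "\<lambda>i. - u i" u]
      by (simp add: emb_uminus odd_Q)
    show "?f \<in> topspace (nsphere (?n - Suc 0)) \<rightarrow> topspace (nsphere (?n - Suc 0))"
    proof
      fix x assume "x \<in> topspace (nsphere (?n - Suc 0))"
      then have x: "x \<in> topspace (nsphere m)" by simp
      show "?f x \<in> topspace (nsphere (?n - Suc 0))"
        using f_m[OF x] sphere_normalize_in_nsphere[of m "\<lambda>x i. Q (emb x) \<bullet> b i"] nzQ[OF x] by simp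
    qed
  qed
  moreover have "Brouwer_degree2 m ?f = Brouwer_degree2 m (sphere_normalize m (\<lambda>x i. Q (emb x) \<bullet> b i))"
    using f_m by (intro Brouwer_degree2_eq)
  moreover have "odd (Brouwer_degree2 m (sphere_normalize m (\<lambda>x i. Q (emb x) \<bullet> b i)))"
    using n by (intro Suc.IH poly_Q odd_Q nzQ) auto
  ultimately show ?case using 1 by simp
qed

end


section \<open>The Borsuk-Ulam theorem\<close>

text \<open>A map without zeros would yield an odd polynomial map whose degree is odd by the
  previous lemma, yet 0 because padding with zero coordinates makes it miss a pole.\<close>

theorem Borsuk_Ulam_zero:
  fixes h :: "'b::euclidean_space \<Rightarrow> 'c::euclidean_space"
  assumes dim: "DIM('c) < DIM('b)"
    and cont: "continuous_on (sphere 0 1) h"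
    and odd: "\<And>x. x \<in> sphere 0 1 \<Longrightarrow> h (- x) = - h x"
  obtains x where "x \<in> sphere 0 1" "h x = 0"
proof (rule ccontr)
  assume "\<not> thesis"
  with that have nz: "h x \<noteq> 0" if "x \<in> sphere 0 1" for x using \<open>x \<in> sphere 0 1\<close> by blast
  have "compact ((\<lambda>x. norm (h x)) ` sphere 0 1)"
    by (intro compact_continuous_image continuous_on_norm cont) auto
  moreover have "(sphere 0 1 :: 'b set) \<noteq> {}" by simp
  ultimately obtain a where a: "a \<in> sphere 0 1" "\<And>x. x \<in> sphere 0 1 \<Longrightarrow> norm (h a) \<le> norm (h x)"
    using compact_attains_inf[of "(\<lambda>x. norm (h x)) ` sphere 0 1"] by auto
  \<comment> \<open>The minimum of the norm of \<open>h\<close> on the sphere: an approximation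
    closer than this has no zero there.\<close>
  define \<delta> where "\<delta> = norm (h a)"
  have "\<delta> > 0" using nz a by (simp add: \<delta>_def)
  obtain g where g: "polynomial_function g" and gh: "\<And>x. x \<in> sphere 0 1 \<Longrightarrow> norm (h x - g x) < \<delta>"
    using Stone_Weierstrass_polynomial_function[OF compact_sphere cont \<open>\<delta> > 0\<close>] by auto
  \<comment> \<open>The odd part of \<open>g\<close>. Since \<open>h\<close> is its own odd part on
    the sphere, the error stays below \<open>\<delta>\<close>.\<close>
  define G where "G x = (1/2) *\<^sub>R (g x - g (- x))" for x
  have poly_G: "polynomial_function G"
  proof -
    have "polynomial_function (\<lambda>x. g (- x))"
      using polynomial_function_compose[OF polynomial_function_minus[OF polynomial_function_id] g]
      by (simp add: o_def)
    then show ?thesis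
      unfolding G_def using g by (intro polynomial_function_cmul polynomial_function_diff)
  qed
  have odd_G: "G (- x) = - G x" for x
    by (simp add: G_def algebra_simps)
  have nz_G: "G x \<noteq> 0" if x: "x \<in> sphere 0 1" for x
  proof
    assume "G x = 0"
    have "h x - G x = (1/2) *\<^sub>R (h x - g x) - (1/2) *\<^sub>R (h (- x) - g (- x))"
    proof -
      have "h x = (1/2) *\<^sub>R h x + (1/2) *\<^sub>R h x" by (simp flip: scaleR_add_left)
      then show ?thesis by (simp add: G_def odd[OF x] algebra_simps)
    qed
    then have "norm (h x) \<le> norm ((1/2) *\<^sub>R (h x - g x)) + norm ((1/2) *\<^sub>R (h (- x) - g (- x)))"
      using norm_triangle_ineq4 \<open>G x = 0\<close> by (metis diff_zero)
    also have "\<dots> < \<delta>"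
      using gh[OF x] gh[of "- x"] x by simp
    finally show False using a(2)[OF x] by (simp add: \<delta>_def)
  qed
  obtain b :: "nat \<Rightarrow> 'b" where "bij_betw b {..<DIM('b)} Basis"
    using ex_bij_betw_nat_finite[of "Basis :: 'b set"] by (auto simp: atLeast0LessThan)
  then interpret b: basis_enumeration b by unfold_locales
  obtain c :: "nat \<Rightarrow> 'c" where "bij_betw c {..<DIM('c)} Basis"
    using ex_bij_betw_nat_finite[of "Basis :: 'c set"] by (auto simp: atLeast0LessThan)
  then interpret c: basis_enumeration c by unfold_locales
  define n where "n = DIM('b) - 1"
  have n: "n < DIM('b)" "DIM('c) \<le> n" "{..<DIM('b)} = {..n}" using dim by (auto simp: n_def)
  \<comment> \<open>Coordinates from \<open>DIM('c)\<close> on are 0; in particular coordinate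
    \<open>n\<close>, so the pole \<open>e\<close> below is never attained.\<close>
  define q where "q y = (\<Sum>i<DIM('c). (G y \<bullet> c i) *\<^sub>R b i)" for y
  have q_b: "q y \<bullet> b i = (if i < DIM('c) then G y \<bullet> c i else 0)" if "i \<le> n" for y i
    unfolding q_def using n(1,2) that by (subst b.sum_inner_b) auto
  have poly_q: "polynomial_function q"
    unfolding q_def
    by (intro polynomial_function_sum polynomial_function_mult polynomial_function_inner poly_G) auto
  have odd_q: "q (- y) = - q y" for y
    by (simp add: q_def odd_G sum_negf)
  have nz_q: "\<exists>i\<le>n. q (b.emb x) \<bullet> b i \<noteq> 0" if "x \<in> topspace (nsphere n)" for x
  proof -
    have "b.emb x \<in> sphere 0 1"
      using that n by (simp add: b.norm_emb nsphere)
    then obtain i where "i < DIM('c)" "G (b.emb x) \<bullet> c i \<noteq> 0"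
      using nz_G c.eq_iff_inner_b[of "G (b.emb x)" 0] by auto
    then show ?thesis using q_b[of i "b.emb x"] n by (intro exI[of _ i]) auto
  qed
  let ?f = "sphere_normalize n (\<lambda>x i. q (b.emb x) \<bullet> b i)"
  have "odd (Brouwer_degree2 n ?f)"
    using poly_q odd_q n(1) nz_q by (rule b.odd_degree_polynomial)
  moreover have "Brouwer_degree2 n ?f = 0"
  proof (rule Brouwer_degree2_nonsurjective)
    have "continuous_on UNIV q"
      using poly_q by (simp add: continuous_on_polymonial_function)
    then show "continuous_map (nsphere n) (nsphere n) ?f"
      using nz_q by (intro continuous_map_sphere_normalize b.continuous_map_coords_emb)
    define e :: "nat \<Rightarrow> real" where "e = (\<lambda>i. if i = n then 1 else 0)"
    have "(\<Sum>i\<le>n. (e i)\<^sup>2) = (\<Sum>i\<le>n. if i = n then 1 else 0)"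
      by (intro sum.cong) (auto simp: e_def)
    then have "e \<in> topspace (nsphere n)" by (simp add: nsphere e_def)
    moreover have "?f x n = 0" for x using q_b[of n] n by (simp add: sphere_normalize_def)
    then have "e \<noteq> ?f x" for x by (auto simp: e_def dest: fun_cong[of _ _ n])
    ultimately show "?f ` topspace (nsphere n) \<noteq> topspace (nsphere n)" by blast
  qed
  ultimately show False by simp
qed

section \<open>Measures of halfspaces as functions of the parameters\<close>

lemma hyperplane_null_sets_ac:
  fixes M :: "'a::euclidean_space measure"
  assumes M: "ac_prob_measure M" and "u \<noteq> 0 \<or> c \<noteq> 0"
  shows "{y. u \<bullet> y = c} \<in> null_sets M"
proof -
  have "{y. u \<bullet> y = c} \<in> null_sets lebesgue"
    using negligible_hyperplane[OF assms(2)] by (simp add: negligible_iff_null_sets)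
  moreover have "{y. u \<bullet> y = c} \<in> sets lborel"
    using closed_hyperplane by auto
  ultimately have "{y. u \<bullet> y = c} \<in> null_sets lborel"
    by (simp add: null_sets_completion_iff)
  then show ?thesis
    using M by (auto simp: ac_prob_measure_def absolutely_continuous_def)
qed

lemma halfspace_sets_ac:
  assumes "ac_prob_measure M"
  shows "halfspace u c \<in> sets M"
proof -
  have "closed (halfspace u c)"
    unfolding halfspace_def using closed_halfspace_ge[of c u] by simp
  then show ?thesis
    using assms by (simp add: ac_prob_measure_def borel_closed)
qed

text \<open>Dominated convergence: the indicators converge off the boundary hyperplane, a null set.
  At the origin continuity fails, since \<open>halfspace 0 0\<close> is the whole space but
  \<open>halfspace 0 c\<close> is empty for every \<open>c > 0\<close>.\<close>

lemma continuous_on_measure_halfspace: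
  fixes M :: "'a::euclidean_space measure"
  assumes M: "ac_prob_measure M"
  shows "continuous_on (- {0}) (\<lambda>x. measure M (halfspace (fst x) (snd x)))"
  unfolding continuous_on_sequentially
proof (intro allI ballI impI; elim conjE)
  fix X and a :: "'a \<times> real"
  assume a: "a \<in> - {0}" and lim: "X \<longlonglongrightarrow> a"
  interpret prob_space M using M by (simp add: ac_prob_measure_def)
  let ?I = "\<lambda>x y. indicator (halfspace (fst x) (snd x)) y :: real"
  have sets: "halfspace u c \<in> sets M" for u c by (rule halfspace_sets_ac[OF M])
  have "(\<lambda>n. \<integral>y. ?I (X n) y \<partial>M) \<longlonglongrightarrow> (\<integral>y. ?I a y \<partial>M)"
  proof (rule integral_dominated_convergence[where w = "\<lambda>_. 1"])
    have "fst a \<noteq> 0 \<or> snd a \<noteq> 0" using a by (auto simp: prod_eq_iff)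
    then have "AE y in M. y \<notin> {y. fst a \<bullet> y = snd a}"
      by (intro AE_not_in hyperplane_null_sets_ac[OF M])
    then show "AE y in M. (\<lambda>n. ?I (X n) y) \<longlonglongrightarrow> ?I a y"
    proof eventually_elim
      case (elim y)
      have l: "(\<lambda>n. fst (X n) \<bullet> y - snd (X n)) \<longlonglongrightarrow> fst a \<bullet> y - snd a"
        using lim by (intro tendsto_intros)
      have "eventually (\<lambda>n. ?I (X n) y = ?I a y) sequentially"
      proof (cases "fst a \<bullet> y - snd a > 0")
        case True
        from order_tendstoD(1)[OF l this] show ?thesis
          by eventually_elim (use True in \<open>auto simp: halfspace_def indicator_def\<close>)
      next
        case False
        then have "fst a \<bullet> y - snd a < 0" using elim by simp
        from order_tendstoD(2)[OF l this] show ?thesis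
          by eventually_elim (use False elim in \<open>auto simp: halfspace_def indicator_def\<close>)
      qed
      then show ?case by (rule tendsto_eventually)
    qed
  qed (use sets in auto)
  then show "((\<lambda>x. measure M (halfspace (fst x) (snd x))) \<circ> X)
      \<longlonglongrightarrow> measure M (halfspace (fst a) (snd a))"
    using sets by (simp add: o_def)
qed

text \<open>The two closed halfspaces cover the space and overlap only in the boundary hyperplane, a
  null set.\<close>

lemma measure_halfspace_uminus:
  fixes M :: "'a::euclidean_space measure"
  assumes M: "ac_prob_measure M" and "u \<noteq> 0 \<or> c \<noteq> 0"
  shows "measure M (halfspace (- u) (- c)) = 1 - measure M (halfspace u c)"
proof -
  interpret prob_space M using M by (simp add: ac_prob_measure_def)
  have space: "space M = UNIV" using M sets_eq_imp_space_eq by (fastforce simp: ac_prob_measure_def)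
  have sets: "halfspace u c \<in> sets M" for u c by (rule halfspace_sets_ac[OF M])
  have "halfspace (- u) (- c) = (space M - halfspace u c) \<union> {y. u \<bullet> y = c}"
    by (auto simp: halfspace_def space)
  then have "measure M (halfspace (- u) (- c)) = measure M (space M - halfspace u c)"
    using hyperplane_null_sets_ac[OF assms] sets by (simp add: measure_Un_null_set)
  then show ?thesis using sets by (simp add: prob_compl)
qed

section \<open>Equalizing the measures by a perturbed odd map\<close>

theorem theorem1:
  fixes \<mu> :: "nat \<Rightarrow> 'a::euclidean_space measure" and eps :: real
  assumes "0 < eps" and "eps < 1/2"
    and "\<And>i. i \<le> DIM('a) \<Longrightarrow> ac_prob_measure (\<mu> i)"
    and "not_permuted eps \<mu>"
  shows "\<exists>H. is_halfspace H \<and>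
           (\<forall>i\<le>DIM('a). measure (\<mu> i) H = measure (\<mu> 0) H) \<and>
           eps \<le> measure (\<mu> 0) H \<and> measure (\<mu> 0) H \<le> 1/2"
proof -
  let ?d = "DIM('a)" and ?S = "sphere 0 1 :: ('a \<times> real) set"
  note eps = assms(1,2) and ac = assms(3) and np = assms(4)
  define f where "f i x = measure (\<mu> i) (halfspace (fst x) (snd x))" for i and x :: "'a \<times> real"
  \<comment> \<open>A continuous nonnegative bump, positive exactly where all measures are below
    \<open>eps\<close>.\<close>
  define \<phi> where "\<phi> x = (\<Prod>i\<le>?d. max 0 (eps - f i x))" for x
  have S0: "?S \<subseteq> - {0}" by auto
  have f_uminus: "f i (- x) = 1 - f i x" if "x \<in> ?S" "i \<le> ?d" for x i
  proof -
    have "fst x \<noteq> 0 \<or> snd x \<noteq> 0" using that by (auto simp: norm_prod_def)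
    from measure_halfspace_uminus[OF ac this] that show ?thesis by (simp add: f_def)
  qed
  have cont_f: "continuous_on ?S (f i)" if "i \<le> ?d" for i
    unfolding f_def using continuous_on_subset[OF continuous_on_measure_halfspace[OF ac[OF that]] S0] .
  have cont_f': "continuous_on ?S (\<lambda>x. f i (- x))" if "i \<le> ?d" for i
    by (intro continuous_on_compose2[OF cont_f[OF that]] continuous_on_minus continuous_on_id)
       (metis image_subset_iff mem_sphere_0 norm_minus_cancel)
  have \<phi>_nonneg: "\<phi> x \<ge> 0" for x by (auto simp: \<phi>_def intro: prod_nonneg)
  have \<phi>_pos_iff: "\<phi> x > 0 \<longleftrightarrow> (\<forall>i\<le>?d. f i x < eps)" for x
  proof -
    have "\<phi> x = 0 \<longleftrightarrow> (\<exists>i\<le>?d. max 0 (eps - f i x) = 0)" by (auto simp: \<phi>_def)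
    moreover have "max 0 (eps - f i x) = 0 \<longleftrightarrow> \<not> f i x < eps" for i by (auto simp: max_def)
    ultimately show ?thesis using \<phi>_nonneg[of x] by (auto simp: less_le)
  qed
  \<comment> \<open>The poles of the parameter sphere stand for the empty set and the whole space,
    to which \<open>not_permuted\<close> does not apply.\<close>
  have degenerate: "f i (0, c) = (if c > 0 then 0 else 1)" if "i \<le> ?d" for i c
  proof -
    interpret prob_space "\<mu> i" using ac[OF that] by (simp add: ac_prob_measure_def)
    have "space (\<mu> i) = UNIV" using ac[OF that] sets_eq_imp_space_eq by (fastforce simp: ac_prob_measure_def)
    then show ?thesis using prob_space by (auto simp: f_def halfspace_def)
  qed
  \<comment> \<open>Equal positive increments would make the measures strictly increasing in the
    index. This contradicts \<open>not_permuted\<close> at a genuine halfspace, and at a pole the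
    fact that all measures agree, as there are at least two of them.\<close>
  have not_increasing: "\<not> (\<forall>i<?d. f (Suc i) x - f i x = \<phi> x)" if "\<phi> x > 0" for x
  proof
    assume *: "\<forall>i<?d. f (Suc i) x - f i x = \<phi> x"
    have mono: "f i x < f j x" if "i < j" "j \<le> ?d" for i j
      using that
    proof (induction j)
      case (Suc j)
      then have "f j x < f (Suc j) x" using *[rule_format, of j] \<open>\<phi> x > 0\<close> by simp
      with Suc show ?case by (cases "i = j") auto
    qed simp
    show False
    proof (cases "fst x = 0")
      case True
      then have "f 0 x = f 1 x" using degenerate[of _ "snd x"] by (cases x) (simp add: Suc_leI)
      then show False using mono[of 0 1] by (simp add: Suc_leI)
    next
      case False
      then have "is_halfspace (halfspace (fst x) (snd x))" by (auto simp: is_halfspace_def)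
      moreover have "\<forall>i\<le>?d. measure (\<mu> i) (halfspace (fst x) (snd x)) < eps"
        using that \<phi>_pos_iff by (simp add: f_def)
      ultimately obtain i j where "i < j" "j \<le> ?d" "f i x \<ge> f j x"
        using np unfolding not_permuted_def f_def by blast
      then show False using mono[of i j] by simp
    qed
  qed
  obtain c :: "nat \<Rightarrow> 'a" where "bij_betw c {..<?d} Basis"
    using ex_bij_betw_nat_finite[of "Basis :: 'a set"] by (auto simp: atLeast0LessThan)
  then interpret c: basis_enumeration c by unfold_locales
  \<comment> \<open>Where \<open>\<phi> > 0\<close> the vector of differences avoids the open positive orthant, so subtracting a positive
    multiple of the all-ones vector creates no zero and removes the existing ones.\<close>
  define h where "h x = c.emb (\<lambda>i. f (Suc i) x - f i x - \<phi> x + \<phi> (- x))" for x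
  obtain x where x: "x \<in> ?S" "h x = 0"
  proof (rule Borsuk_Ulam_zero)
    show "DIM('a) < DIM('a \<times> real)" by simp
    show "continuous_on ?S h"
      unfolding h_def c.emb_def \<phi>_def
      by (intro continuous_intros cont_f cont_f') auto
    show "h (- x) = - h x" if "x \<in> ?S" for x
      using that by (auto simp: h_def c.eq_iff_inner_b f_uminus)
  qed
  have step: "f (Suc i) x - f i x = \<phi> x - \<phi> (- x)" if "i < ?d" for i
    using x(2) that c.emb_inner[of i "\<lambda>i. f (Suc i) x - f i x - \<phi> x + \<phi> (- x)"] by (simp add: h_def)
  have step': "f (Suc i) (- x) - f i (- x) = \<phi> (- x) - \<phi> x" if "i < ?d" for i
    using step[OF that] f_uminus[OF x(1)] that by simp
  \<comment> \<open>The values of \<open>f 0\<close> at \<open>x\<close> and \<open>- x\<close> add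
    up to 1, so they cannot both be below \<open>eps < 1/2\<close>.\<close>
  have disjoint: "\<not> (\<phi> x > 0 \<and> \<phi> (- x) > 0)"
    using \<phi>_pos_iff[of x] \<phi>_pos_iff[of "- x"] f_uminus[OF x(1), of 0] eps by fastforce
  have "\<not> \<phi> x > 0"
  proof
    assume "\<phi> x > 0"
    then have "\<phi> (- x) = 0" using disjoint \<phi>_nonneg[of "- x"] by linarith
    then show False using not_increasing[OF \<open>\<phi> x > 0\<close>] step by simp
  qed
  moreover have "\<not> \<phi> (- x) > 0"
  proof
    assume "\<phi> (- x) > 0"
    then have "\<phi> x = 0" using disjoint \<phi>_nonneg[of x] by linarith
    then show False using not_increasing[OF \<open>\<phi> (- x) > 0\<close>] step' by simp
  qed
  ultimately have \<phi>0: "\<phi> x = 0" "\<phi> (- x) = 0" using \<phi>_nonneg[of x] \<phi>_nonneg[of "- x"] by linarith+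
  have eq: "f i x = f 0 x" if "i \<le> ?d" for i
    using that by (induction i) (use step \<phi>0 in auto)
  \<comment> \<open>A vanishing bump only says that some measure is at least \<open>eps\<close>;
    equality extends this to all. The same at \<open>- x\<close> gives the upper bound.\<close>
  have ge: "eps \<le> f 0 x"
  proof -
    obtain i where "i \<le> ?d" "eps \<le> f i x"
      using \<phi>_pos_iff[of x] \<phi>0 by (metis less_irrefl not_less)
    then show ?thesis using eq[of i] by simp
  qed
  have le: "f 0 x \<le> 1 - eps"
  proof -
    obtain i where "i \<le> ?d" "eps \<le> f i (- x)"
      using \<phi>_pos_iff[of "- x"] \<phi>0 by (metis less_irrefl not_less)
    then show ?thesis using eq[of i] f_uminus[OF x(1), of i] by simp
  qed
  \<comment> \<open>At a pole the common value would be 0 or 1, outside the interval from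
    \<open>eps\<close> to \<open>1 - eps\<close>.\<close>
  have u: "fst x \<noteq> 0"
  proof
    assume "fst x = 0"
    then have "f 0 x = (if snd x > 0 then 0 else 1)" using degenerate[of 0 "snd x"] by (cases x) simp
    then show False using ge le eps by (auto split: if_splits)
  qed
  define z where "z = (if f 0 x \<le> 1/2 then x else - x)"
  have "f i z = f 0 z" if "i \<le> ?d" for i
    using eq[OF that] f_uminus[OF x(1)] that by (simp add: z_def)
  moreover have "eps \<le> f 0 z" "f 0 z \<le> 1/2"
    using ge le f_uminus[OF x(1), of 0] by (auto simp: z_def)
  moreover have "is_halfspace (halfspace (fst z) (snd z))"
  proof -
    have "fst z \<noteq> 0" using u by (simp add: z_def)
    then show ?thesis by (auto simp: is_halfspace_def)
  qed
  ultimately show ?thesis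
    unfolding f_def by blast
qed

end
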